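(* Let $m\ge1$ and let $D\ge2$ be even. Then $P_{D,m}$ is an irreducible polynomial of degree $m$ on $\mathrm{Sym}^D\mathbb{C}^m$.
   Context: $\mathrm{Sym}^D\mathbb{C}^m$ is the space of forms of degree $D$ in $m$ variables over $\mathbb{C}$, identified with the space of symmetric tensors $v=\sum_{1\le\nu_1,\dots,\nu_D\le m}v(\nu_1,\dots,\nu_D)\,e_{\nu_1}\otimes\cdots\otimes e_{\nu_D}$ in $\bigotimes^D\mathbb{C}^m$. $P_{D,m}\colon\mathrm{Sym}^D\mathbb{C}^m\to\mathbb{C}$ is the $\mathrm{SL}_m$-invariant polynomial $$P_{D,m}(v)=\sum_{\sigma_1,\dots,\sigma_D\in S_m}\Big[\prod_{j=1}^D\mathrm{sgn}(\sigma_j)\Big]\prod_{i=1}^m v(\sigma_1(i),\dots,\sigma_D(i)).$$ *)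

theory Defs
  imports
    Complex_Main
    "HOL-Library.FuncSet"
    "HOL-Library.Multiset"
    "HOL-Combinatorics.Permutations"
    "HOL-Algebra.Ring_Divisibility"
begin

section \<open>Polynomial functions on a space of complex coordinate vectors\<close>

text \<open>
  Here \<open>V\<close> is a linear subspace of \<open>'i \<Rightarrow> complex\<close>, consisting of vectors
  that vanish outside the finite index set \<open>I\<close>. Its coordinates \<open>v i\<close>
  (\<open>i \<in> I\<close>) span the dual space of \<open>V\<close>, possibly with linear relations
  between them. A multiset \<open>M\<close> of indices stands for the monomial
  \<open>\<Prod>i\<in>#M. v i\<close>, of degree \<open>size M\<close>. Since the complex field is infinite, polynomials
  on \<open>V\<close> are the same as polynomial functions on \<open>V\<close>; these are
  represented by extensional functions on \<open>V\<close>.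
\<close>

definition poly_funs_le ::
    "'i set \<Rightarrow> ('i \<Rightarrow> complex) set \<Rightarrow> nat \<Rightarrow> (('i \<Rightarrow> complex) \<Rightarrow> complex) set" where
  "poly_funs_le I V d =
     {f \<in> extensional V.
        \<exists>F c. finite F \<and> (\<forall>M\<in>F. set_mset M \<subseteq> I \<and> size M \<le> d) \<and>
              (\<forall>v\<in>V. f v = (\<Sum>M\<in>F. c M * (\<Prod>i\<in>#M. v i)))}"

text \<open>
  The degree is the least one among all polynomials in the (possibly dependent) coordinates
  that represent the function; eliminating dependent coordinates does not raise the degree,
  so this is the degree in any linear coordinate system of \<open>V\<close>. The zero function gets degree 0.
\<close>

definition poly_fun_degree ::
    "'i set \<Rightarrow> ('i \<Rightarrow> complex) set \<Rightarrow> (('i \<Rightarrow> complex) \<Rightarrow> complex) \<Rightarrow> nat" where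
  "poly_fun_degree I V f = (LEAST d. f \<in> poly_funs_le I V d)"

definition poly_fun_ring ::
    "'i set \<Rightarrow> ('i \<Rightarrow> complex) set \<Rightarrow> (('i \<Rightarrow> complex) \<Rightarrow> complex) ring" where
  "poly_fun_ring I V =
     \<lparr>carrier = (\<Union>d. poly_funs_le I V d),
      mult = (\<lambda>f g. \<lambda>v\<in>V. f v * g v),
      one = (\<lambda>v\<in>V. 1),
      zero = (\<lambda>v\<in>V. 0),
      add = (\<lambda>f g. \<lambda>v\<in>V. f v + g v)\<rparr>"

section \<open>Symmetric tensors\<close>

text \<open>A multi-index \<open>(\<nu>\<^sub>1, \<dots>, \<nu>\<^sub>D)\<close> is an extensional function \<open>\<nu>\<close> on \<open>{1..D}\<close>.\<close>

definition tensor_index :: "nat \<Rightarrow> nat \<Rightarrow> (nat \<Rightarrow> nat) set" where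
  "tensor_index D m = {1..D} \<rightarrow>\<^sub>E {1..m}"

text \<open>
  A symmetric tensor is given by its coefficients \<open>v \<nu>\<close>, set to 0 outside
  \<open>tensor_index D m\<close>.
\<close>

definition Sym_tensors :: "nat \<Rightarrow> nat \<Rightarrow> ((nat \<Rightarrow> nat) \<Rightarrow> complex) set" where
  "Sym_tensors D m =
     {v. (\<forall>\<nu>. \<nu> \<notin> tensor_index D m \<longrightarrow> v \<nu> = 0) \<and>
         (\<forall>\<nu>\<in>tensor_index D m. \<forall>\<pi>. \<pi> permutes {1..D} \<longrightarrow> v (\<nu> \<circ> \<pi>) = v \<nu>)}"

definition P_inv :: "nat \<Rightarrow> nat \<Rightarrow> ((nat \<Rightarrow> nat) \<Rightarrow> complex) \<Rightarrow> complex" where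
  "P_inv D m =
     (\<lambda>v\<in>Sym_tensors D m.
        \<Sum>\<sigma>\<in>{1..D} \<rightarrow>\<^sub>E {\<pi>. \<pi> permutes {1..m}}.
          (\<Prod>j\<in>{1..D}. of_int (sign (\<sigma> j))) *
          (\<Prod>i\<in>{1..m}. v (\<lambda>j\<in>{1..D}. \<sigma> j i)))"

text \<open>The coordinate ring of the space of symmetric tensors, and the degree on it.\<close>

abbreviation Sym_poly_ring ::
    "nat \<Rightarrow> nat \<Rightarrow> (((nat \<Rightarrow> nat) \<Rightarrow> complex) \<Rightarrow> complex) ring" where
  "Sym_poly_ring D m \<equiv> poly_fun_ring (tensor_index D m) (Sym_tensors D m)"

abbreviation Sym_poly_degree ::
    "nat \<Rightarrow> nat \<Rightarrow> (((nat \<Rightarrow> nat) \<Rightarrow> complex) \<Rightarrow> complex) \<Rightarrow> nat" where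
  "Sym_poly_degree D m \<equiv> poly_fun_degree (tensor_index D m) (Sym_tensors D m)"

end

theory Submission
  imports Defs "HOL-Computational_Algebra.Fundamental_Theorem_Algebra"
begin

text \<open>
  Let \<open>l\<^sub>0 = (1, \<dots>, 1)\<close> and let \<open>l\<^sub>1, \<dots>, l\<^sub>m\<close> be the unit vectors. On a tensor
  \<open>v\<^sub>c = \<Sum>k\<le>m. c\<^sub>k l\<^sub>k\<^bsup>\<otimes>D\<^esup>\<close> the sum over \<open>\<sigma>\<^sub>1, \<dots>, \<sigma>\<^sub>D\<close> factors into \<open>D\<close> equal determinants,
  which gives (\<open>P_inv_power_sum\<close>) \<open>P(v\<^sub>c) = \<Sum>\<kappa>. (\<Prod>i. c\<^bsub>\<kappa>(i)\<^esub>) det(l\<^bsub>\<kappa>(1)\<^esub>, \<dots>, l\<^bsub>\<kappa>(m)\<^esub>)\<^bsup>D\<^esup>\<close>,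
  where \<open>\<kappa>\<close> runs over the maps from \<open>{1..m}\<close> to \<open>{0..m}\<close>. Any \<open>m\<close> distinct ones among the
  \<open>l\<^sub>k\<close> have determinant \<open>1\<close> or \<open>-1\<close>, so for even \<open>D\<close> nothing cancels, and \<open>P(v\<^sub>c)\<close> is \<open>m!\<close>
  times the elementary symmetric polynomial of degree \<open>m\<close> in the \<open>m + 1\<close> variables
  \<open>c\<^sub>0, \<dots>, c\<^sub>m\<close>.

  Suppose \<open>P = f g\<close>, and put \<open>F(c) = f(v\<^sub>c)\<close>, \<open>G(c) = g(v\<^sub>c)\<close>. The product \<open>F G\<close> is affine in
  each variable, so each variable occurs in at most one of \<open>F\<close> and \<open>G\<close>
  (\<open>affine_variable_in_one_factor\<close>). Suppose that \<open>c\<^sub>j\<close> occurs in \<open>F\<close> and \<open>c\<^sub>i\<close> in \<open>G\<close>, and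
  consider the points with all coordinates \<open>1\<close> except for some zeros. The product does not
  vanish if there is one zero, so \<open>F\<close> is nonzero for the zero at \<open>j\<close> and \<open>G\<close> for the zero at
  \<open>i\<close>. Putting a second zero at \<open>i\<close> does not change \<open>F\<close>, nor does one at \<open>j\<close> change \<open>G\<close>; so
  the product does not vanish for the two zeros \<open>i, j\<close> either, which is false. Hence one of
  \<open>F\<close> and \<open>G\<close> depends on no variable at all and is a nonzero constant. In particular,
  \<open>f(0) \<noteq> 0\<close> or \<open>g(0) \<noteq> 0\<close> (\<open>factor_nonzero_at_origin\<close>).

  Since \<open>P\<close> is homogeneous, a factor that does not vanish at \<open>0\<close> has no zero on any ray on
  which \<open>P\<close> is not identically zero. By the fundamental theorem of algebra it is constant
  there, hence constant everywhere, hence a unit (\<open>constant_factor_of_homogeneous\<close>). This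
  proves irreducibility. Homogeneity and \<open>P \<noteq> 0\<close> also give the degree.

  All of these arguments only look at functions on lines, where they are polynomials in one
  variable.
\<close>

section \<open>Functions that are polynomial along lines\<close>

text \<open>
  For nonempty \<open>V\<close> this says that \<open>V\<close> is a linear subspace: \<open>u - u\<close> gives \<open>0\<close>.
\<close>

definition lin_closed :: "('i \<Rightarrow> complex) set \<Rightarrow> bool" where
  "lin_closed V \<longleftrightarrow> (\<forall>u\<in>V. \<forall>w\<in>V. \<forall>t. (\<lambda>i. u i + t * w i) \<in> V)"

definition poly_on_lines :: "('i \<Rightarrow> complex) set \<Rightarrow> (('i \<Rightarrow> complex) \<Rightarrow> complex) \<Rightarrow> bool" where
  "poly_on_lines V f \<longleftrightarrow> (\<forall>u\<in>V. \<forall>w\<in>V. \<exists>p. \<forall>t. f (\<lambda>i. u i + t * w i) = poly p t)"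

lemma lin_closed_UNIV: "lin_closed UNIV"
  by (simp add: lin_closed_def)

lemma lin_closedD:
  assumes "lin_closed V" "u \<in> V" "w \<in> V"
  shows "(\<lambda>i. u i + t * w i) \<in> V"
  using assms by (simp add: lin_closed_def)

lemma lin_closed_diff:
  assumes "lin_closed V" "u \<in> V" "w \<in> V"
  shows "(\<lambda>i. u i - w i) \<in> V"
proof -
  show ?thesis using lin_closedD[OF assms, of "- 1"] by simp
qed

lemma lin_closed_zero:
  assumes "lin_closed V" "u \<in> V"
  shows "(\<lambda>i. 0) \<in> V"
  using lin_closed_diff[OF assms(1,2,2)] by simp

lemma poly_on_linesE:
  assumes "poly_on_lines V f" "u \<in> V" "w \<in> V"
  obtains p where "\<And>t. f (\<lambda>i. u i + t * w i) = poly p t"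
  using assms unfolding poly_on_lines_def by blast

lemma poly_on_lines_mult:
  assumes "poly_on_lines V f" "poly_on_lines V g"
  shows "poly_on_lines V (\<lambda>v. f v * g v)"
  unfolding poly_on_lines_def
proof (intro ballI)
  fix u w assume "u \<in> V" "w \<in> V"
  then obtain p q where "\<forall>t. f (\<lambda>i. u i + t * w i) = poly p t" "\<forall>t. g (\<lambda>i. u i + t * w i) = poly q t"
    using assms unfolding poly_on_lines_def by blast
  then show "\<exists>r. \<forall>t. f (\<lambda>i. u i + t * w i) * g (\<lambda>i. u i + t * w i) = poly r t"
    by (intro exI[of _ "p * q"]) simp
qed

lemma poly_on_lines_diff:
  assumes "poly_on_lines V f" "poly_on_lines V g"
  shows "poly_on_lines V (\<lambda>v. f v - g v)"
  unfolding poly_on_lines_def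
proof (intro ballI)
  fix u w assume "u \<in> V" "w \<in> V"
  then obtain p q where "\<forall>t. f (\<lambda>i. u i + t * w i) = poly p t" "\<forall>t. g (\<lambda>i. u i + t * w i) = poly q t"
    using assms unfolding poly_on_lines_def by blast
  then show "\<exists>r. \<forall>t. f (\<lambda>i. u i + t * w i) - g (\<lambda>i. u i + t * w i) = poly r t"
    by (intro exI[of _ "p - q"]) simp
qed

lemma poly_on_lines_const: "poly_on_lines V (\<lambda>v. a)"
  unfolding poly_on_lines_def by (metis poly_const_conv)

text \<open>
  Suppose that \<open>f a\<close> and \<open>g b\<close> were both nonzero. On the line through \<open>a\<close> and \<open>b\<close> both
  functions would be nonzero polynomials in one variable, and so would their product.
\<close>

lemma poly_on_lines_no_zero_divisors:
  assumes V: "lin_closed V"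
    and f: "poly_on_lines V f" and g: "poly_on_lines V g"
    and fg: "\<And>v. v \<in> V \<Longrightarrow> f v * g v = 0"
    and a: "a \<in> V" "f a \<noteq> 0" and b: "b \<in> V"
  shows "g b = 0"
proof -
  define w where "w = (\<lambda>i. b i - a i)"
  have w: "w \<in> V" unfolding w_def using V a b by (blast intro: lin_closed_diff)
  obtain p where p: "\<And>t. f (\<lambda>i. a i + t * w i) = poly p t"
    using poly_on_linesE[OF f \<open>a \<in> V\<close> w] by blast
  obtain q where q: "\<And>t. g (\<lambda>i. a i + t * w i) = poly q t"
    using poly_on_linesE[OF g \<open>a \<in> V\<close> w] by blast
  have "poly (p * q) t = 0" for t
    using fg[of "\<lambda>i. a i + t * w i"] V a w unfolding lin_closed_def by (simp add: p q)
  then have "p * q = 0" using poly_all_0_iff_0 by blast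
  moreover have "p \<noteq> 0" using p[of 0] a by auto
  ultimately have "q = 0" by simp
  then show ?thesis using q[of 1] by (simp add: w_def)
qed

text \<open>
  On a ray \<open>t \<mapsto> t v\<close> with \<open>h v \<noteq> 0\<close>, the zeros of \<open>f\<close> are zeros of \<open>t ^ m * h v\<close>, so \<open>t = 0\<close>
  is the only candidate; \<open>f(0) \<noteq> 0\<close> excludes it as well. A complex polynomial without zeros
  is constant, so \<open>f v = f(0)\<close>. This holds wherever \<open>h \<noteq> 0\<close>, that is, \<open>h * (f - f(0))\<close>
  vanishes on \<open>V\<close>, and \<open>h\<close> can be cancelled.
\<close>

lemma constant_factor_of_homogeneous:
  assumes V: "lin_closed V"
    and f: "poly_on_lines V f" and g: "poly_on_lines V g"
    and fg: "\<And>v. v \<in> V \<Longrightarrow> f v * g v = h v"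
    and hom: "\<And>v t. v \<in> V \<Longrightarrow> h (\<lambda>i. t * v i) = t ^ m * h v"
    and a: "a \<in> V" "h a \<noteq> 0"
    and f0: "f (\<lambda>i. 0) \<noteq> 0" and b: "b \<in> V"
  shows "f b = f (\<lambda>i. 0)"
proof -
  note z = lin_closed_zero[OF V \<open>a \<in> V\<close>]
  have ray: "f v = f (\<lambda>i. 0)" if v: "v \<in> V" "h v \<noteq> 0" for v
  proof -
    obtain p where p': "\<And>t. f (\<lambda>i. 0 + t * v i) = poly p t"
      using poly_on_linesE[OF f z \<open>v \<in> V\<close>] by blast
    have p: "f (\<lambda>i. t * v i) = poly p t" for t using p'[of t] by simp
    have tv: "(\<lambda>i. t * v i) \<in> V" for t
      using lin_closedD[OF V z \<open>v \<in> V\<close>, of t] by simp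
    have "poly p t \<noteq> 0" for t
    proof (cases "t = 0")
      case True
      then show ?thesis using p[of 0] f0 by simp
    next
      case False
      then have "h (\<lambda>i. t * v i) \<noteq> 0" using hom v by simp
      then show ?thesis using fg[OF tv[of t]] p[of t] by auto
    qed
    then have "constant (poly p)" using fundamental_theorem_of_algebra by blast
    then have "poly p 1 = poly p 0" unfolding constant_def by blast
    then show ?thesis using p[of 0] p[of 1] by simp
  qed
  have h: "poly_on_lines V h"
    unfolding poly_on_lines_def
  proof (intro ballI)
    fix u w assume uw: "u \<in> V" "w \<in> V"
    have fg': "f (\<lambda>i. u i + t * w i) * g (\<lambda>i. u i + t * w i) = h (\<lambda>i. u i + t * w i)" for t
      by (rule fg[OF lin_closedD[OF V uw]])
    show "\<exists>p. \<forall>t. h (\<lambda>i. u i + t * w i) = poly p t"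
      using poly_on_linesE[OF poly_on_lines_mult[OF f g] uw] unfolding fg' by blast
  qed
  have "f b - f (\<lambda>i. 0) = 0"
    by (rule poly_on_lines_no_zero_divisors[OF V h
          poly_on_lines_diff[OF f poly_on_lines_const] _ a b]) (use ray in auto)
  then show ?thesis by simp
qed

section \<open>Factors of multi-affine polynomials\<close>

lemma poly_on_lines_update:
  assumes "poly_on_lines UNIV F"
  shows "poly_on_lines UNIV (\<lambda>c. F (c(i := s)))"
  unfolding poly_on_lines_def
proof (intro ballI)
  fix u w :: "'a \<Rightarrow> complex"
  obtain p where p: "\<And>t. F (\<lambda>k. (u(i := s)) k + t * (w(i := 0)) k) = poly p t"
    using poly_on_linesE[OF assms, of "u(i := s)" "w(i := 0)"] by blast
  have "(\<lambda>k. u k + t * w k)(i := s) = (\<lambda>k. (u(i := s)) k + t * (w(i := 0)) k)" for t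
    by auto
  then show "\<exists>p. \<forall>t. F ((\<lambda>k. u k + t * w k)(i := s)) = poly p t"
    using p by auto
qed

text \<open>
  At a point where \<open>F G\<close> does not vanish, \<open>F\<close> and \<open>G\<close> as polynomials in the \<open>i\<close>-th variable
  alone have degrees with sum at most 1, so one of them is constant in that variable. Which
  one it is could depend on the point. To exclude this, dependence on the variable is
  detected by nonvanishing of a difference \<open>F(c(i := s)) - F(c(i := t))\<close> with fixed \<open>s\<close> and
  \<open>t\<close>, which is again polynomial along lines: the product of such differences for \<open>F\<close> and \<open>G\<close>
  vanishes wherever \<open>F G\<close> does not, hence identically, hence one of them is identically zero.
\<close>

lemma affine_variable_in_one_factor:
  assumes F: "poly_on_lines UNIV F" and G: "poly_on_lines UNIV G"
    and affine: "\<And>c. \<exists>a b. \<forall>t. F (c(i := t)) * G (c(i := t)) = a + b * t"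
    and nz: "F z * G z \<noteq> 0"
  shows "(\<forall>c t. F (c(i := t)) = F c) \<or> (\<forall>c t. G (c(i := t)) = G c)"
proof (rule ccontr)
  assume "\<not> ?thesis"
  then obtain c1 t1 c2 t2 where
    1: "F (c1(i := t1)) \<noteq> F c1" and 2: "G (c2(i := t2)) \<noteq> G c2" by blast
  \<comment> \<open>The values \<open>c1 i\<close> and \<open>c2 i\<close> make \<open>A c1\<close> and \<open>B c2\<close> the nonzero differences in \<open>1\<close> and \<open>2\<close>.\<close>
  define A where "A = (\<lambda>c. F (c(i := t1)) - F (c(i := c1 i)))"
  define B where "B = (\<lambda>c. G (c(i := t2)) - G (c(i := c2 i)))"
  have A: "poly_on_lines UNIV A" and B: "poly_on_lines UNIV B"
    unfolding A_def B_def by (intro poly_on_lines_diff poly_on_lines_update F G)+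
  have line: "\<exists>p. \<forall>t. X (c(i := t)) = poly p t" if "poly_on_lines UNIV X" for X and c :: "'a \<Rightarrow> complex"
  proof -
    have "(\<lambda>k. (c(i := 0)) k + t * ((\<lambda>k. 0)(i := 1)) k) = c(i := t)" for t by auto
    then show ?thesis
      using poly_on_linesE[OF that, of "c(i := 0)" "(\<lambda>k. 0)(i := 1)"] by (metis UNIV_I)
  qed
  have "A c * B c = 0" if c: "F c * G c \<noteq> 0" for c
  proof -
    obtain p q where p: "\<And>t. F (c(i := t)) = poly p t" and q: "\<And>t. G (c(i := t)) = poly q t"
      using line[OF F] line[OF G] by metis
    obtain a b where "\<And>t. F (c(i := t)) * G (c(i := t)) = a + b * t" using affine by blast
    then have "poly (p * q) t = poly [:a, b:] t" for t by (simp add: p q mult.commute)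
    then have eq: "p * q = [:a, b:]" by (intro poly_eqI_degree_lead_coeff poly_ext) auto
    have "poly p (c i) * poly q (c i) \<noteq> 0" using c p[of "c i"] q[of "c i"] by simp
    then have "p \<noteq> 0" "q \<noteq> 0" by auto
    then have "degree p + degree q = degree [:a, b:]" using eq degree_mult_eq[of p q] by metis
    also have "\<dots> \<le> 1" by simp
    finally have "degree p + degree q \<le> 1" .
    then have "degree p = 0 \<or> degree q = 0" by linarith
    then show ?thesis
      by (auto simp: A_def B_def p q elim!: degree_eq_zeroE)
  qed
  then have *: "(F c * G c) * (A c * B c) = 0" for c by force
  have "A c * B c = 0" for c
    by (rule poly_on_lines_no_zero_divisors[where a = z, OF lin_closed_UNIV
          poly_on_lines_mult[OF F G] poly_on_lines_mult[OF A B]]) (use * nz in auto)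
  then have "B c2 = 0"
    by (intro poly_on_lines_no_zero_divisors[OF lin_closed_UNIV A B, of c1]) (use 1 in \<open>auto simp: A_def\<close>)
  then show False using 2 by (simp add: B_def)
qed

text \<open>
  \<open>E S\<close> is the indicator vector of \<open>S\<close>. If each factor depended on some variable, \<open>F\<close> on \<open>j\<close>
  and \<open>G\<close> on \<open>i\<close>, then \<open>F\<close> would not depend on \<open>i\<close> nor \<open>G\<close> on \<open>j\<close>, and the factors at
  \<open>E (K - {i, j})\<close> would equal the nonzero numbers \<open>F (E (K - {j}))\<close> and \<open>G (E (K - {i}))\<close>.
  So one factor depends on no variable in \<open>K\<close>, and its value at the origin is its nonzero
  value at \<open>E (K - {k})\<close>.
\<close>

lemma factor_nonzero_at_origin:
  fixes F G :: "('k \<Rightarrow> complex) \<Rightarrow> complex"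
  defines "E \<equiv> \<lambda>S k. of_bool (k \<in> S)"
  assumes K: "finite K" "K \<noteq> {}"
    and F: "poly_on_lines UNIV F" and G: "poly_on_lines UNIV G"
    and affine: "\<And>i c. i \<in> K \<Longrightarrow> \<exists>a b. \<forall>t. F (c(i := t)) * G (c(i := t)) = a + b * t"
    and one: "\<And>i. i \<in> K \<Longrightarrow> F (E (K - {i})) * G (E (K - {i})) \<noteq> 0"
    and two: "\<And>i j. i \<in> K \<Longrightarrow> j \<in> K \<Longrightarrow> i \<noteq> j \<Longrightarrow> F (E (K - {i, j})) * G (E (K - {i, j})) = 0"
  shows "F (E {}) \<noteq> 0 \<or> G (E {}) \<noteq> 0"
proof -
  define indep :: "(('k \<Rightarrow> complex) \<Rightarrow> complex) \<Rightarrow> 'k \<Rightarrow> bool"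
    where "indep X i \<longleftrightarrow> (\<forall>c t. X (c(i := t)) = X c)" for X i
  obtain k where k: "k \<in> K" using K by blast
  have dich: "indep F i \<or> indep G i" if "i \<in> K" for i
    unfolding indep_def
    by (rule affine_variable_in_one_factor[where z = "E (K - {k})", OF F G])
      (use affine[OF that] one[OF k] in auto)
  have ins: "X (E (insert i S)) = X (E S)" if "indep X i" for X i S
  proof -
    have "E (insert i S) = (E S)(i := 1)" unfolding E_def by auto
    then show ?thesis using that by (simp add: indep_def)
  qed
  have const: "X (E S) = X (E {})" if "\<forall>i\<in>K. indep X i" "S \<subseteq> K" for X S
  proof -
    have "finite S" using that K finite_subset by blast
    then show ?thesis using \<open>S \<subseteq> K\<close>
    proof (induction S)
      case (insert i S)
      then show ?case using ins[of X i S] that(1) by simp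
    qed simp
  qed
  show ?thesis
  proof (cases "(\<forall>i\<in>K. indep F i) \<or> (\<forall>i\<in>K. indep G i)")
    case True
    then show ?thesis using const[of F "K - {k}"] const[of G "K - {k}"] one[OF k] by auto
  next
    case False
    then obtain i j where ij: "i \<in> K" "j \<in> K" "\<not> indep G i" "\<not> indep F j" by blast
    then have Fi: "indep F i" and Gj: "indep G j" using dich by blast+
    have "i \<noteq> j" using Fi ij by blast
    have "insert i (K - {i, j}) = K - {j}" "insert j (K - {i, j}) = K - {i}"
      using ij \<open>i \<noteq> j\<close> by auto
    then have "F (E (K - {i, j})) \<noteq> 0" "G (E (K - {i, j})) \<noteq> 0"
      using ins[OF Fi, of "K - {i, j}"] ins[OF Gj, of "K - {i, j}"]
        one[OF ij(1)] one[OF ij(2)] by auto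
    then show ?thesis using two[OF ij(1,2) \<open>i \<noteq> j\<close>] by simp
  qed
qed

section \<open>Polynomial functions as a ring\<close>

lemma poly_fun_on_line:
  assumes f: "f \<in> poly_funs_le I V d" and V: "lin_closed V" and uw: "u \<in> V" "w \<in> V"
  shows "\<exists>p. degree p \<le> d \<and> (\<forall>t. f (\<lambda>i. u i + t * w i) = poly p t)"
proof -
  obtain F c where F: "finite F" "\<And>M. M \<in> F \<Longrightarrow> size M \<le> d"
    and fv: "\<And>v. v \<in> V \<Longrightarrow> f v = (\<Sum>M\<in>F. c M * (\<Prod>i\<in>#M. v i))"
    using f unfolding poly_funs_le_def by blast
  define r where "r = (\<lambda>M. \<Prod>i\<in>#M. [:u i, w i:])"
  have r_deg: "degree (r M) \<le> size M" for M
  proof (induction M)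
    case (add x M)
    have "degree (r (add_mset x M)) \<le> degree [:u x, w x:] + degree (r M)"
      unfolding r_def image_mset_add_mset prod_mset.add_mset by (rule degree_mult_le)
    also have "\<dots> \<le> 1 + size M" using add by (intro add_mono) auto
    finally show ?case by simp
  qed (simp add: r_def)
  have r_val: "poly (r M) t = (\<Prod>i\<in>#M. u i + t * w i)" for M t
    by (induction M) (simp_all add: r_def algebra_simps)
  define p where "p = (\<Sum>M\<in>F. smult (c M) (r M))"
  have "degree p \<le> d"
    unfolding p_def using F r_deg by (intro degree_sum_le) (auto intro: order_trans degree_smult_le)
  moreover have "f (\<lambda>i. u i + t * w i) = poly p t" for t
    using V uw unfolding lin_closed_def by (simp add: fv p_def poly_sum r_val)
  ultimately show ?thesis by blast
qed

lemma poly_fun_poly_on_lines: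
  assumes "f \<in> poly_funs_le I V d" "lin_closed V"
  shows "poly_on_lines V f"
  unfolding poly_on_lines_def using poly_fun_on_line[OF assms] by blast

text \<open>
  Polynomial functions are defined through sums with one coefficient for each monomial. This
  rule admits sums in which monomials repeat, by collecting the coefficients.
\<close>

lemma poly_funs_le_indexed_sum:
  assumes "f \<in> extensional V" "finite S"
    and M: "\<And>s. s \<in> S \<Longrightarrow> set_mset (M s) \<subseteq> I \<and> size (M s) \<le> d"
    and f: "\<And>v. v \<in> V \<Longrightarrow> f v = (\<Sum>s\<in>S. a s * (\<Prod>i\<in>#M s. v i))"
  shows "f \<in> poly_funs_le I V d"
proof -
  define c where "c = (\<lambda>N. \<Sum>s\<in>{s\<in>S. M s = N}. a s)"
  have "f v = (\<Sum>N\<in>M ` S. c N * (\<Prod>i\<in>#N. v i))" if "v \<in> V" for v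
  proof -
    have "f v = (\<Sum>N\<in>M ` S. \<Sum>s\<in>{s\<in>S. M s = N}. a s * (\<Prod>i\<in>#M s. v i))"
      unfolding f[OF that] using \<open>finite S\<close> by (rule sum.image_gen)
    also have "\<dots> = (\<Sum>N\<in>M ` S. c N * (\<Prod>i\<in>#N. v i))"
      unfolding c_def sum_distrib_right by (intro sum.cong) auto
    finally show ?thesis .
  qed
  then show ?thesis
    unfolding poly_funs_le_def using assms by (intro CollectI conjI exI[of _ "M ` S"] exI[of _ c]) auto
qed

lemma const_in_poly_fun_ring: "(\<lambda>v\<in>V. a) \<in> carrier (poly_fun_ring I V)"
proof -
  have "(\<lambda>v\<in>V. a) \<in> poly_funs_le I V 0"
    by (rule poly_funs_le_indexed_sum[of _ _ "{()}" "\<lambda>_. {#}" _ _ "\<lambda>_. a"]) auto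
  then show ?thesis unfolding poly_fun_ring_def by auto
qed

text \<open>
  The units that matter are the nonzero constants. In a factorization \<open>P = f g\<close> the factor
  that is nonzero at the origin is constant: if it is \<open>f\<close>, then \<open>f\<close> is a unit; if it is \<open>g\<close>,
  then \<open>P\<close> divides \<open>f\<close>, which is therefore not a proper factor.
\<close>

lemma irreducible_poly_funI:
  assumes V: "lin_closed V"
    and P: "P \<in> carrier (poly_fun_ring I V)"
    and hom: "\<And>v t. v \<in> V \<Longrightarrow> P (\<lambda>i. t * v i) = t ^ m * P v" and m: "m > 0"
    and a: "a \<in> V" "P a \<noteq> 0"
    and fact: "\<And>f g. poly_on_lines V f \<Longrightarrow> poly_on_lines V g \<Longrightarrow> (\<And>v. v \<in> V \<Longrightarrow> f v * g v = P v)
       \<Longrightarrow> f (\<lambda>i. 0) \<noteq> 0 \<or> g (\<lambda>i. 0) \<noteq> 0"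
  shows "ring_irreducible\<^bsub>poly_fun_ring I V\<^esub> P"
proof -
  let ?R = "poly_fun_ring I V"
  have mult: "f \<otimes>\<^bsub>?R\<^esub> g = (\<lambda>v\<in>V. f v * g v)" and one: "\<one>\<^bsub>?R\<^esub> = (\<lambda>v\<in>V. 1)"
    and zero: "\<zero>\<^bsub>?R\<^esub> = (\<lambda>v\<in>V. 0)" for f g
    unfolding poly_fun_ring_def by auto
  have ext: "f \<in> extensional V" and lines: "poly_on_lines V f" if f: "f \<in> carrier ?R" for f
  proof -
    obtain d where d: "f \<in> poly_funs_le I V d" using f unfolding poly_fun_ring_def by auto
    show "f \<in> extensional V" using d unfolding poly_funs_le_def by blast
    show "poly_on_lines V f" using d V by (rule poly_fun_poly_on_lines)
  qed
  note z = lin_closed_zero[OF V \<open>a \<in> V\<close>]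
  have P0: "P (\<lambda>i. 0) = 0" using hom[OF \<open>a \<in> V\<close>, of 0] m by simp
  have "P \<noteq> \<zero>\<^bsub>?R\<^esub>" using a unfolding zero by auto
  moreover have "P \<notin> Units ?R"
  proof
    assume "P \<in> Units ?R"
    then obtain g where "(\<lambda>v\<in>V. P v * g v) = (\<lambda>v\<in>V. 1)"
      unfolding Units_def mult one by blast
    from fun_cong[OF this, of "\<lambda>i. 0"] show False using P0 z by simp
  qed
  moreover have "f \<in> Units ?R" if f: "f \<in> carrier ?R" and pf: "properfactor ?R f P" for f
  proof -
    obtain g where g: "g \<in> carrier ?R" and Pfg: "P = (\<lambda>v\<in>V. f v * g v)"
      using pf unfolding properfactor_def factor_def mult by blast
    have fg: "f v * g v = P v" if "v \<in> V" for v using that by (simp add: Pfg)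
    then have gf: "g v * f v = P v" if "v \<in> V" for v using that by (simp add: mult.commute)
    consider "f (\<lambda>i. 0) \<noteq> 0" | "g (\<lambda>i. 0) \<noteq> 0" using fact[OF lines[OF f] lines[OF g] fg] by blast
    then show ?thesis
    proof cases
      case 1
      have const: "f v = f (\<lambda>i. 0)" if "v \<in> V" for v
        using constant_factor_of_homogeneous[OF V lines[OF f] lines[OF g] fg hom a 1 that] .
      define h where "h = (\<lambda>v\<in>V. inverse (f (\<lambda>i. 0)))"
      have "f \<otimes>\<^bsub>?R\<^esub> h = \<one>\<^bsub>?R\<^esub>" "h \<otimes>\<^bsub>?R\<^esub> f = \<one>\<^bsub>?R\<^esub>"
        unfolding mult one h_def using 1 by (auto intro!: restrict_ext simp: const)
      moreover have "h \<in> carrier ?R" unfolding h_def by (rule const_in_poly_fun_ring)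
      ultimately show ?thesis unfolding Units_def using f by blast
    next
      case 2
      have const: "g v = g (\<lambda>i. 0)" if "v \<in> V" for v
        using constant_factor_of_homogeneous[OF V lines[OF g] lines[OF f] gf hom a 2 that] .
      define h where "h = (\<lambda>v\<in>V. inverse (g (\<lambda>i. 0)))"
      have "f = P \<otimes>\<^bsub>?R\<^esub> h"
      proof
        fix v show "f v = (P \<otimes>\<^bsub>?R\<^esub> h) v"
          using 2 fg[of v] const[of v] ext[OF f]
          by (cases "v \<in> V") (auto simp: mult h_def extensional_def field_simps)
      qed
      moreover have "h \<in> carrier ?R" unfolding h_def by (rule const_in_poly_fun_ring)
      ultimately have "P divides\<^bsub>?R\<^esub> f" unfolding factor_def by blast
      then show ?thesis using pf unfolding properfactor_def by blast
    qed
  qed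
  ultimately show ?thesis unfolding ring_irreducible_def Divisibility.irreducible_def by blast
qed

text \<open>
  On the ray through a point \<open>a\<close> with \<open>P a \<noteq> 0\<close>, the function is \<open>t ^ m * P a\<close>, while
  membership in \<open>poly_funs_le I V d\<close> gives there a polynomial in \<open>t\<close> of degree at most \<open>d\<close>.
\<close>

lemma poly_fun_degree_homogeneous:
  assumes V: "lin_closed V" and P: "P \<in> poly_funs_le I V m"
    and hom: "\<And>v t. v \<in> V \<Longrightarrow> P (\<lambda>i. t * v i) = t ^ m * P v"
    and a: "a \<in> V" "P a \<noteq> 0"
  shows "poly_fun_degree I V P = m"
  unfolding poly_fun_degree_def
proof (rule Least_equality)
  show "P \<in> poly_funs_le I V m" by (rule P)
next
  fix d assume "P \<in> poly_funs_le I V d"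
  then obtain p where p: "degree p \<le> d" "\<And>t. P (\<lambda>i. 0 + t * a i) = poly p t"
    using poly_fun_on_line[OF _ V lin_closed_zero[OF V \<open>a \<in> V\<close>] \<open>a \<in> V\<close>] by blast
  have "poly p t = poly (monom (P a) m) t" for t
    using p(2)[of t] hom[OF \<open>a \<in> V\<close>, of t] by (simp add: poly_monom mult.commute)
  then have "p = monom (P a) m" by (intro poly_ext) auto
  then show "m \<le> d" using p(1) a by (simp add: degree_monom_eq)
qed

section \<open>The invariant on sums of powers of linear forms\<close>

text \<open>
  Rows and columns are indexed by \<open>{1..m}\<close> with \<open>m\<close> a variable, and the definition has the
  shape in which determinants arise from \<open>P_inv\<close>.
\<close>

definition leibniz_det :: "nat \<Rightarrow> (nat \<Rightarrow> nat \<Rightarrow> 'a::comm_ring_1) \<Rightarrow> 'a" where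
  "leibniz_det m A = (\<Sum>p | p permutes {1..m}. of_int (sign p) * (\<Prod>i\<in>{1..m}. A i (p i)))"

lemma of_int_leibniz_det:
  "of_int (leibniz_det m A) = leibniz_det m (\<lambda>i j. of_int (A i j))"
  by (simp add: leibniz_det_def)

lemma leibniz_det_equal_rows:
  fixes A :: "nat \<Rightarrow> nat \<Rightarrow> int"
  assumes ab: "a \<in> {1..m}" "b \<in> {1..m}" "a \<noteq> b" and eq: "A a = A b"
  shows "leibniz_det m A = 0"
proof -
  let ?\<tau> = "transpose a b"
  have \<tau>: "?\<tau> permutes {1..m}" using ab by (intro permutes_swap_id)
  have row: "A (?\<tau> i) = A i" for i using eq by (auto simp: transpose_def)
  have "leibniz_det m A =
      (\<Sum>p | p permutes {1..m}. of_int (sign (p \<circ> ?\<tau>)) * (\<Prod>i\<in>{1..m}. A i ((p \<circ> ?\<tau>) i)))"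
    unfolding leibniz_det_def by (rule sum_permutations_compose_right[OF \<tau>])
  also have "\<dots> = (\<Sum>p | p permutes {1..m}. - (of_int (sign p) * (\<Prod>i\<in>{1..m}. A i (p i))))"
  proof (intro sum.cong refl)
    fix p assume "p \<in> {p. p permutes {1..m}}"
    then have p: "permutation p" using permutation_permutes by blast
    have "sign (p \<circ> ?\<tau>) = - sign p"
      using ab(3) by (simp add: sign_compose[OF p] sign_swap_id permutation_swap_id)
    moreover have "(\<Prod>i\<in>{1..m}. A i ((p \<circ> ?\<tau>) i)) = (\<Prod>i\<in>{1..m}. A i (p i))"
    proof -
      have "(\<Prod>i\<in>{1..m}. A i (p i)) = (\<Prod>i\<in>{1..m}. A (?\<tau> i) (p (?\<tau> i)))"
        using prod.permute[OF \<tau>, of "\<lambda>i. A i (p i)"] by (simp add: o_def)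
      then show ?thesis by (simp add: row)
    qed
    ultimately show "of_int (sign (p \<circ> ?\<tau>)) * (\<Prod>i\<in>{1..m}. A i ((p \<circ> ?\<tau>) i)) =
        - (of_int (sign p) * (\<Prod>i\<in>{1..m}. A i (p i)))" by simp
  qed
  also have "\<dots> = - leibniz_det m A" by (simp add: leibniz_det_def sum_negf)
  finally show ?thesis by simp
qed

text \<open>
  The tensor \<open>\<Sum>k\<in>K. c k l\<^sub>k\<^bsup>\<otimes>D\<^esup>\<close>; as a form of degree \<open>D\<close>, this is a combination of \<open>D\<close>-th
  powers of linear forms.
\<close>

definition power_sum ::
    "nat \<Rightarrow> nat \<Rightarrow> 'k set \<Rightarrow> ('k \<Rightarrow> nat \<Rightarrow> complex) \<Rightarrow> ('k \<Rightarrow> complex) \<Rightarrow> (nat \<Rightarrow> nat) \<Rightarrow> complex" where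
  "power_sum D m K l c \<nu> =
     (if \<nu> \<in> tensor_index D m then \<Sum>k\<in>K. c k * (\<Prod>j\<in>{1..D}. l k (\<nu> j)) else 0)"

lemma permuted_tensor_index:
  assumes "\<nu> \<in> tensor_index D m" "\<pi> permutes {1..D}"
  shows "\<nu> \<circ> \<pi> \<in> tensor_index D m"
  using assms permutes_in_image[OF assms(2)] permutes_not_in[OF assms(2)]
  unfolding tensor_index_def by (fastforce simp: PiE_iff extensional_def)

lemma power_sum_symmetric: "power_sum D m K l c \<in> Sym_tensors D m"
proof -
  have "power_sum D m K l c (\<nu> \<circ> \<pi>) = power_sum D m K l c \<nu>"
    if \<nu>: "\<nu> \<in> tensor_index D m" and \<pi>: "\<pi> permutes {1..D}" for \<nu> \<pi>
  proof -
    have "(\<Prod>j\<in>{1..D}. l k ((\<nu> \<circ> \<pi>) j)) = (\<Prod>j\<in>{1..D}. l k (\<nu> j))" for k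
      using prod.permute[OF \<pi>, of "\<lambda>j. l k (\<nu> j)"] by (simp add: o_def)
    then show ?thesis
      using \<nu> permuted_tensor_index[OF \<nu> \<pi>] by (simp add: power_sum_def)
  qed
  then show ?thesis unfolding Sym_tensors_def by (simp add: power_sum_def)
qed

lemma power_sum_linear:
  "power_sum D m K l (\<lambda>k. c k + t * d k) =
     (\<lambda>\<nu>. power_sum D m K l c \<nu> + t * power_sum D m K l d \<nu>)"
  by (auto simp: power_sum_def fun_eq_iff algebra_simps sum.distrib sum_distrib_left)

lemma column_in_tensor_index:
  assumes "\<sigma> \<in> {1..D} \<rightarrow>\<^sub>E {\<pi>. \<pi> permutes {1..m}}" "i \<in> {1..m}"
  shows "(\<lambda>j\<in>{1..D}. \<sigma> j i) \<in> tensor_index D m"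
  unfolding tensor_index_def
proof (rule restrict_PiE_iff[THEN iffD2], rule ballI)
  fix j assume "j \<in> {1..D}"
  then have "\<sigma> j permutes {1..m}" using assms(1) by (auto simp: PiE_iff)
  then show "\<sigma> j i \<in> {1..m}" using assms(2) by (simp only: permutes_in_image)
qed

text \<open>
  A form of the Cauchy-Binet formula. Expand the product over \<open>i\<close> of the sums over \<open>k\<close>; \<open>\<kappa> i\<close>
  is the summand chosen in the \<open>i\<close>-th factor. For fixed \<open>\<kappa>\<close>, the \<open>\<sigma> j\<close> with different \<open>j\<close>
  occur in different factors, so the sum over \<open>\<sigma>\<close> is a product of \<open>D\<close> independent sums over
  permutations, each of which is a determinant.
\<close>

lemma P_inv_power_sum:
  assumes K: "finite K"
  shows "P_inv D m (power_sum D m K l c) =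
    (\<Sum>\<kappa>\<in>{1..m} \<rightarrow>\<^sub>E K. (\<Prod>i\<in>{1..m}. c (\<kappa> i)) * leibniz_det m (\<lambda>i. l (\<kappa> i)) ^ D)"
proof -
  let ?S = "{1..D} \<rightarrow>\<^sub>E {\<pi>. \<pi> permutes {1..m}}"
  have fin: "finite {\<pi>. \<pi> permutes {1..m}}" by (simp add: finite_permutations)
  have "P_inv D m (power_sum D m K l c) =
      (\<Sum>\<sigma>\<in>?S. (\<Prod>j\<in>{1..D}. of_int (sign (\<sigma> j))) *
        (\<Prod>i\<in>{1..m}. power_sum D m K l c (\<lambda>j\<in>{1..D}. \<sigma> j i)))"
    by (simp add: P_inv_def power_sum_symmetric)
  also have "\<dots> = (\<Sum>\<sigma>\<in>?S. \<Sum>\<kappa>\<in>{1..m} \<rightarrow>\<^sub>E K. (\<Prod>i\<in>{1..m}. c (\<kappa> i)) *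
      (\<Prod>j\<in>{1..D}. of_int (sign (\<sigma> j)) * (\<Prod>i\<in>{1..m}. l (\<kappa> i) (\<sigma> j i))))"
  proof (rule sum.cong[OF refl])
    fix \<sigma> assume \<sigma>: "\<sigma> \<in> ?S"
    have "(\<Prod>i\<in>{1..m}. power_sum D m K l c (\<lambda>j\<in>{1..D}. \<sigma> j i)) =
        (\<Prod>i\<in>{1..m}. \<Sum>k\<in>K. c k * (\<Prod>j\<in>{1..D}. l k (\<sigma> j i)))"
      using column_in_tensor_index[OF \<sigma>] by (intro prod.cong refl) (simp add: power_sum_def)
    also have "\<dots> = (\<Sum>\<kappa>\<in>{1..m} \<rightarrow>\<^sub>E K. \<Prod>i\<in>{1..m}. c (\<kappa> i) * (\<Prod>j\<in>{1..D}. l (\<kappa> i) (\<sigma> j i)))"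
      using K by (intro prod_sum_PiE) auto
    also have "\<dots> = (\<Sum>\<kappa>\<in>{1..m} \<rightarrow>\<^sub>E K. (\<Prod>i\<in>{1..m}. c (\<kappa> i)) *
        (\<Prod>j\<in>{1..D}. \<Prod>i\<in>{1..m}. l (\<kappa> i) (\<sigma> j i)))"
      by (subst prod.swap) (simp add: prod.distrib)
    finally show "(\<Prod>j\<in>{1..D}. of_int (sign (\<sigma> j))) *
        (\<Prod>i\<in>{1..m}. power_sum D m K l c (\<lambda>j\<in>{1..D}. \<sigma> j i)) =
      (\<Sum>\<kappa>\<in>{1..m} \<rightarrow>\<^sub>E K. (\<Prod>i\<in>{1..m}. c (\<kappa> i)) *
        (\<Prod>j\<in>{1..D}. of_int (sign (\<sigma> j)) * (\<Prod>i\<in>{1..m}. l (\<kappa> i) (\<sigma> j i))))"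
      by (simp add: sum_distrib_left prod.distrib mult_ac)
  qed
  also have "\<dots> = (\<Sum>\<kappa>\<in>{1..m} \<rightarrow>\<^sub>E K. (\<Prod>i\<in>{1..m}. c (\<kappa> i)) *
      (\<Sum>\<sigma>\<in>?S. \<Prod>j\<in>{1..D}. of_int (sign (\<sigma> j)) * (\<Prod>i\<in>{1..m}. l (\<kappa> i) (\<sigma> j i))))"
    by (subst sum.swap) (simp add: sum_distrib_left)
  also have "\<dots> = (\<Sum>\<kappa>\<in>{1..m} \<rightarrow>\<^sub>E K. (\<Prod>i\<in>{1..m}. c (\<kappa> i)) * leibniz_det m (\<lambda>i. l (\<kappa> i)) ^ D)"
  proof (rule sum.cong[OF refl], rule arg_cong[where f = "(*) _"])
    fix \<kappa>
    show "(\<Sum>\<sigma>\<in>?S. \<Prod>j\<in>{1..D}. of_int (sign (\<sigma> j)) * (\<Prod>i\<in>{1..m}. l (\<kappa> i) (\<sigma> j i))) =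
        leibniz_det m (\<lambda>i. l (\<kappa> i)) ^ D"
      using prod_sum_PiE[of "{1..D}" "\<lambda>_. {\<pi>. \<pi> permutes {1..m}}"
          "\<lambda>_ p. of_int (sign p) * (\<Prod>i\<in>{1..m}. l (\<kappa> i) (p i))"] fin
      by (simp add: leibniz_det_def)
  qed
  finally show ?thesis .
qed

section \<open>The unit vectors together with the all-ones vector\<close>

text \<open>
  The vector with number 0 is \<open>(1, \<dots>, 1)\<close>, and the one with number \<open>k \<ge> 1\<close> is the \<open>k\<close>-th unit
  vector. These \<open>m + 1\<close> vectors are a circuit: they are linearly dependent, but any \<open>m\<close> of
  them form a basis. The entries are integers so that even powers of their determinants are
  nonnegative.
\<close>

definition circuit_vector :: "nat \<Rightarrow> nat \<Rightarrow> int" where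
  "circuit_vector k j = (if k = 0 \<or> k = j then 1 else 0)"

text \<open>
  The matrix is the identity matrix, with row \<open>i\<close> replaced by ones if \<open>1 \<le> i \<le> m\<close>. A
  permutation that contributes to the determinant fixes every \<open>r \<noteq> i\<close>, and then also \<open>i\<close>.
\<close>

lemma circuit_minor_eq_1:
  assumes \<kappa>: "\<And>r. r \<in> {1..m} \<Longrightarrow> \<kappa> r = (if r = i then 0 else r)"
  shows "leibniz_det m (\<lambda>r. circuit_vector (\<kappa> r)) = 1"
proof -
  let ?f = "\<lambda>p. of_int (sign p) * (\<Prod>r\<in>{1..m}. circuit_vector (\<kappa> r) (p r))"
  have "?f p = 0" if p: "p permutes {1..m}" "p \<noteq> id" for p
  proof (rule ccontr)
    assume "?f p \<noteq> 0"
    then have nz: "circuit_vector (\<kappa> r) (p r) \<noteq> 0" if "r \<in> {1..m}" for r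
      using that by (auto simp: prod_zero_iff)
    then have fixed: "p r = r" if "r \<noteq> i" for r
      using \<kappa>[of r] nz[of r] that permutes_not_in[OF p(1), of r]
      by (cases "r \<in> {1..m}") (auto simp: circuit_vector_def split: if_splits)
    have "p i = i"
    proof (rule ccontr)
      assume "p i \<noteq> i"
      then have "p (p i) = p i" by (rule fixed)
      then show False using \<open>p i \<noteq> i\<close> permutes_inj[OF p(1)] by (simp add: inj_eq)
    qed
    then have "p r = r" for r using fixed by (cases "r = i") auto
    then have "p = id" by auto
    then show False using p by simp
  qed
  then have "leibniz_det m (\<lambda>r. circuit_vector (\<kappa> r)) = (\<Sum>p\<in>{id}. ?f p)"
    unfolding leibniz_det_def
    by (intro sum.mono_neutral_right) (auto simp: finite_permutations permutes_id)
  also have "\<dots> = 1" using \<kappa> by (auto simp: circuit_vector_def sign_id intro!: prod.neutral)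
  finally show ?thesis .
qed

text \<open>
  For even \<open>D \<ge> 2\<close> this is \<open>m!\<close> times the elementary symmetric polynomial of degree \<open>m\<close> in
  \<open>c 0, \<dots>, c m\<close>.
\<close>

definition circuit_form :: "nat \<Rightarrow> nat \<Rightarrow> (nat \<Rightarrow> complex) \<Rightarrow> complex" where
  "circuit_form D m c = P_inv D m (power_sum D m {0..m} (\<lambda>k j. of_int (circuit_vector k j)) c)"

lemma circuit_form_expansion:
  "circuit_form D m c = (\<Sum>\<kappa>\<in>{1..m} \<rightarrow>\<^sub>E {0..m}. (\<Prod>i\<in>{1..m}. c (\<kappa> i)) *
     of_int (leibniz_det m (\<lambda>i. circuit_vector (\<kappa> i)) ^ D))"
  by (simp add: circuit_form_def P_inv_power_sum of_int_leibniz_det)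

text \<open>
  If \<open>\<kappa>\<close> takes a value twice, two rows of the determinant agree and the term vanishes. In the
  other terms the variable \<open>c k\<close> occurs at most once.
\<close>

lemma circuit_form_affine:
  assumes D: "D > 0"
  shows "\<exists>a b. \<forall>t. circuit_form D m (c(k := t)) = a + b * t"
proof -
  let ?d = "\<lambda>\<kappa>. of_int (leibniz_det m (\<lambda>i. circuit_vector (\<kappa> i)) ^ D) :: complex"
  have "\<exists>a b. \<forall>t. (\<Prod>i\<in>{1..m}. (c(k := t)) (\<kappa> i)) * ?d \<kappa> = a + b * t" for \<kappa>
  proof (cases "inj_on \<kappa> {1..m}")
    case False
    then obtain r s where "r \<in> {1..m}" "s \<in> {1..m}" "r \<noteq> s" "\<kappa> r = \<kappa> s"
      unfolding inj_on_def by blast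
    then have "?d \<kappa> = 0" using leibniz_det_equal_rows[of r m s] D by simp
    then show ?thesis by (intro exI[of _ 0]) simp
  next
    case inj: True
    show ?thesis
    proof (cases "k \<in> \<kappa> ` {1..m}")
      case False
      then have "(\<Prod>i\<in>{1..m}. (c(k := t)) (\<kappa> i)) = (\<Prod>i\<in>{1..m}. c (\<kappa> i))" for t
        by (intro prod.cong) auto
      then show ?thesis by (intro exI[of _ "(\<Prod>i\<in>{1..m}. c (\<kappa> i)) * ?d \<kappa>"] exI[of _ 0]) simp
    next
      case True
      then obtain r where r: "r \<in> {1..m}" "\<kappa> r = k" by blast
      have "(\<Prod>i\<in>{1..m}. (c(k := t)) (\<kappa> i)) = t * (\<Prod>i\<in>{1..m} - {r}. c (\<kappa> i))" for t
      proof -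
        have "\<kappa> i \<noteq> k" if "i \<in> {1..m} - {r}" for i
          using that r inj by (auto dest: inj_onD)
        then show ?thesis using r by (subst prod.remove[of _ r]) (auto intro!: prod.cong)
      qed
      then show ?thesis
        by (intro exI[of _ 0] exI[of _ "(\<Prod>i\<in>{1..m} - {r}. c (\<kappa> i)) * ?d \<kappa>"]) simp
    qed
  qed
  then obtain a b where
    "\<And>\<kappa> t. (\<Prod>i\<in>{1..m}. (c(k := t)) (\<kappa> i)) * ?d \<kappa> = a \<kappa> + b \<kappa> * t" by metis
  then show ?thesis
    unfolding circuit_form_expansion
    by (intro exI[of _ "\<Sum>\<kappa>\<in>{1..m} \<rightarrow>\<^sub>E {0..m}. a \<kappa>"] exI[of _ "\<Sum>\<kappa>\<in>{1..m} \<rightarrow>\<^sub>E {0..m}. b \<kappa>"])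
      (simp add: sum.distrib sum_distrib_right del: fun_upd_apply)
qed

text \<open>
  A term can be nonzero only if \<open>\<kappa>\<close> maps the \<open>m\<close> indices injectively into the \<open>m - 1\<close> indices
  other than \<open>i\<close> and \<open>j\<close>.
\<close>

lemma circuit_form_two_zeros:
  assumes D: "D > 0" and ij: "i \<in> {0..m}" "j \<in> {0..m}" "i \<noteq> j"
  shows "circuit_form D m (\<lambda>k. of_bool (k \<in> {0..m} - {i, j})) = 0"
  unfolding circuit_form_expansion
proof (intro sum.neutral ballI)
  fix \<kappa>
  show "(\<Prod>r\<in>{1..m}. of_bool (\<kappa> r \<in> {0..m} - {i, j})) *
      (of_int (leibniz_det m (\<lambda>r. circuit_vector (\<kappa> r)) ^ D) :: complex) = 0"
  proof (cases "\<kappa> ` {1..m} \<subseteq> {0..m} - {i, j}")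
    case True
    have "card ({0..m} - {i, j}) < card {1..m}"
      using ij by (subst card_Diff_subset) auto
    then have "\<not> inj_on \<kappa> {1..m}"
      using card_inj_on_le[OF _ True] by force
    then obtain r s where "r \<in> {1..m}" "s \<in> {1..m}" "r \<noteq> s" "\<kappa> r = \<kappa> s"
      unfolding inj_on_def by blast
    then have "leibniz_det m (\<lambda>r. circuit_vector (\<kappa> r)) = 0"
      using leibniz_det_equal_rows[of r m s] by simp
    then show ?thesis using D by simp
  next
    case False
    then obtain r where "r \<in> {1..m}" "\<kappa> r \<notin> {0..m} - {i, j}" by blast
    then have "(\<Prod>r\<in>{1..m}. of_bool (\<kappa> r \<in> {0..m} - {i, j})) = (0 :: complex)"
      by (intro prod_zero) (auto intro!: bexI[of _ r])
    then show ?thesis by simp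
  qed
qed

text \<open>
  All terms are nonnegative integers because \<open>D\<close> is even, so one positive term suffices.
\<close>

lemma circuit_form_one_zero:
  assumes D: "even D" and i: "i \<in> {0..m}"
  shows "circuit_form D m (\<lambda>k. of_bool (k \<in> {0..m} - {i})) \<noteq> 0"
proof -
  let ?d = "\<lambda>\<kappa>. leibniz_det m (\<lambda>r. circuit_vector (\<kappa> r)) ^ D"
  define N :: int where
    "N = (\<Sum>\<kappa>\<in>{1..m} \<rightarrow>\<^sub>E {0..m}. (\<Prod>r\<in>{1..m}. of_bool (\<kappa> r \<in> {0..m} - {i})) * ?d \<kappa>)"
  define \<kappa>0 where "\<kappa>0 = (\<lambda>r\<in>{1..m}. if r = i then 0 else r)"
  have "0 < N" unfolding N_def
  proof (rule sum_pos2)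
    show "\<kappa>0 \<in> {1..m} \<rightarrow>\<^sub>E {0..m}" by (auto simp: \<kappa>0_def)
    have "?d \<kappa>0 = 1" by (subst circuit_minor_eq_1[of _ _ i]) (auto simp: \<kappa>0_def)
    moreover have "(\<Prod>r\<in>{1..m}. of_bool (\<kappa>0 r \<in> {0..m} - {i})) = (1 :: int)"
      by (intro prod.neutral) (auto simp: \<kappa>0_def)
    ultimately show "0 < (\<Prod>r\<in>{1..m}. of_bool (\<kappa>0 r \<in> {0..m} - {i})) * ?d \<kappa>0" by simp
    show "0 \<le> (\<Prod>r\<in>{1..m}. of_bool (\<kappa> r \<in> {0..m} - {i})) * ?d \<kappa>" for \<kappa>
      using D by (intro mult_nonneg_nonneg prod_nonneg) (auto simp: zero_le_even_power)
  qed (auto intro: finite_PiE)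
  moreover have "circuit_form D m (\<lambda>k. of_bool (k \<in> {0..m} - {i})) = of_int N"
    unfolding circuit_form_expansion N_def by simp
  ultimately show ?thesis by simp
qed

section \<open>Irreducibility\<close>

lemma lin_closed_Sym_tensors: "lin_closed (Sym_tensors D m)"
  unfolding lin_closed_def Sym_tensors_def by auto

lemma P_inv_in_poly_funs_le: "P_inv D m \<in> poly_funs_le (tensor_index D m) (Sym_tensors D m) m"
proof (rule poly_funs_le_indexed_sum)
  let ?S = "{1..D} \<rightarrow>\<^sub>E {\<pi>. \<pi> permutes {1..m}}"
  let ?M = "\<lambda>\<sigma>. image_mset (\<lambda>i. \<lambda>j\<in>{1..D}. \<sigma> j i) (mset_set {1..m})"
  show "P_inv D m \<in> extensional (Sym_tensors D m)" by (simp add: P_inv_def)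
  show "finite ?S" by (intro finite_PiE) (auto simp: finite_permutations)
  show "set_mset (?M \<sigma>) \<subseteq> tensor_index D m \<and> size (?M \<sigma>) \<le> m" if "\<sigma> \<in> ?S" for \<sigma>
    using column_in_tensor_index[OF that] by auto
  show "P_inv D m v = (\<Sum>\<sigma>\<in>?S. (\<Prod>j\<in>{1..D}. of_int (sign (\<sigma> j))) * (\<Prod>\<nu>\<in>#?M \<sigma>. v \<nu>))"
    if "v \<in> Sym_tensors D m" for v
    using that by (simp add: P_inv_def prod_unfold_prod_mset multiset.map_comp o_def)
qed

lemma P_inv_homogeneous:
  assumes v: "v \<in> Sym_tensors D m"
  shows "P_inv D m (\<lambda>\<nu>. t * v \<nu>) = t ^ m * P_inv D m v"
proof -
  have "(\<lambda>\<nu>. t * v \<nu>) \<in> Sym_tensors D m" using v unfolding Sym_tensors_def by auto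
  then show ?thesis using v by (simp add: P_inv_def prod.distrib sum_distrib_left mult_ac)
qed

theorem lemma3p19:
  fixes m D :: nat
  assumes "m \<ge> 1" and "D \<ge> 2" and "even D"
  shows "P_inv D m \<in> carrier (Sym_poly_ring D m) \<and>
         ring_irreducible\<^bsub>Sym_poly_ring D m\<^esub> (P_inv D m) \<and>
         Sym_poly_degree D m (P_inv D m) = m"
proof -
  let ?V = "Sym_tensors D m"
  let ?K = "{0..m}"
  let ?v = "power_sum D m ?K (\<lambda>k j. of_int (circuit_vector k j))"
  let ?a = "?v (\<lambda>k. of_bool (k \<in> ?K - {0}))"
  note V = lin_closed_Sym_tensors[of D m]
  have a: "?a \<in> ?V" by (rule power_sum_symmetric)
  have Pa: "P_inv D m ?a \<noteq> 0" using circuit_form_one_zero[of D 0 m] \<open>even D\<close> by (simp add: circuit_form_def)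
  have carrier: "P_inv D m \<in> carrier (Sym_poly_ring D m)"
    using P_inv_in_poly_funs_le unfolding poly_fun_ring_def by auto
  have "ring_irreducible\<^bsub>Sym_poly_ring D m\<^esub> (P_inv D m)"
  proof (rule irreducible_poly_funI[where a = ?a and m = m, OF V carrier])
    show "P_inv D m (\<lambda>\<nu>. t * v \<nu>) = t ^ m * P_inv D m v" if "v \<in> ?V" for v t
      using that by (rule P_inv_homogeneous)
    show "?a \<in> ?V" "P_inv D m ?a \<noteq> 0" by (fact a, fact Pa)
    show "0 < m" using \<open>m \<ge> 1\<close> by simp
    fix f g
    assume f: "poly_on_lines ?V f" and g: "poly_on_lines ?V g"
      and fg: "\<And>v. v \<in> ?V \<Longrightarrow> f v * g v = P_inv D m v"
    have pull: "poly_on_lines UNIV (\<lambda>c. h (?v c))" if "poly_on_lines ?V h" for h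
      using that unfolding poly_on_lines_def power_sum_linear by (blast intro: power_sum_symmetric)
    have fgv: "f (?v c) * g (?v c) = circuit_form D m c" for c
      unfolding circuit_form_def by (rule fg[OF power_sum_symmetric])
    have "f (?v (\<lambda>k. of_bool (k \<in> {}))) \<noteq> 0 \<or> g (?v (\<lambda>k. of_bool (k \<in> {}))) \<noteq> 0"
      using circuit_form_affine[of D m] circuit_form_one_zero[of D _ m] circuit_form_two_zeros[of D _ m] assms
      by (intro factor_nonzero_at_origin[where K = ?K
            and F = "\<lambda>c. f (?v c)" and G = "\<lambda>c. g (?v c)"] pull f g)
        (simp_all only: fgv, auto)
    moreover have "?v (\<lambda>k. of_bool (k \<in> {})) = (\<lambda>\<nu>. 0)" by (auto simp: power_sum_def)
    ultimately show "f (\<lambda>\<nu>. 0) \<noteq> 0 \<or> g (\<lambda>\<nu>. 0) \<noteq> 0" by simp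
  qed
  moreover have "Sym_poly_degree D m (P_inv D m) = m"
    by (rule poly_fun_degree_homogeneous[where a = ?a, OF V P_inv_in_poly_funs_le])
      (use P_inv_homogeneous a Pa in auto)
  ultimately show ?thesis using carrier by blast
qed

end
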